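(* For every positive even integer $n$, $$\left[A_{n,1/4}^{-1}\right] = \left[2\left(n-\tfrac{1}{2}\right)^{1/4}\right],$$ and for every positive odd integer $n$, $$\left[B_{n,1/4}^{-1}\right] = \left[-2\left(n-\tfrac{1}{2}\right)^{1/4}\right].$$
   Context: For a positive integer $n$ and real $0<s<1$, define $A_{n,s} = \sum_{j=0}^{\infty}\left(\frac{1}{(n+2j)^s}-\frac{1}{(n+2j+1)^s}\right)$ and $B_{n,s} = \sum_{j=0}^{\infty}\left(-\frac{1}{(n+2j)^s}+\frac{1}{(n+2j+1)^s}\right)$. Here $A_{n,s}^{-1}=1/A_{n,s}$, $B_{n,s}^{-1}=1/B_{n,s}$, and $[x]$ denotes the greatest integer less than or equal to $x$. *)

theory Defs
  imports Complex_Main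
begin

text \<open>
  Both definitions are meant for \<open>n \<ge> 1\<close> and \<open>0 < s < 1\<close>, where the grouped series converge.
\<close>

definition A :: "nat \<Rightarrow> real \<Rightarrow> real" where
  "A n s = (\<Sum>j::nat. 1 / real (n + 2 * j) powr s - 1 / real (n + 2 * j + 1) powr s)"

definition B :: "nat \<Rightarrow> real \<Rightarrow> real" where
  "B n s = (\<Sum>j::nat. - (1 / real (n + 2 * j) powr s) + 1 / real (n + 2 * j + 1) powr s)"

end

theory Submission
  imports Defs "HOL-Analysis.Convex"
begin

text \<open>
  Write \<open>f x = x powr - s\<close>. Comparing the series for \<open>A n s\<close> termwise with the telescoping series
  of \<open>f (n - 1/2) / 2\<close> and of \<open>f n / 2\<close>, by convexity arguments, gives
  \<open>2 * (n - 1/2) powr s \<le> 1 / A n s < 2 * n powr s\<close>. For \<open>s = 1/4\<close> an integer \<open>m\<close> between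
  the outer bounds would satisfy \<open>16 * n - 8 \<le> m ^ 4 < 16 * n\<close>, which is impossible because
  fourth powers are 0 or 1 modulo 16.
\<close>

text \<open>With \<open>f x = x powr - s\<close>, the function \<open>f (c - t) - f (c + t)\<close>
  vanishes at \<open>t = 0\<close> and is convex in \<open>t\<close>, because \<open>f''\<close> is
  decreasing. Hence its value at 1/2 is at most half its value at 1.\<close>

lemma powr_neg_central_difference:
  fixes c s :: real
  assumes "c > 1" "s \<ge> 0"
  shows "(c - 1/2) powr - s - (c + 1/2) powr - s \<le> ((c - 1) powr - s - (c + 1) powr - s) / 2"
proof -
  let ?h = "\<lambda>t. (c - t) powr - s - (c + t) powr - s"
  let ?h' = "\<lambda>t. s * (c - t) powr (- s - 1) + s * (c + t) powr (- s - 1)"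
  let ?h'' = "\<lambda>t. s * (s + 1) * ((c - t) powr (- s - 2) - (c + t) powr (- s - 2))"
  have "convex_on {0..1} ?h"
  proof (rule f''_ge0_imp_convex)
    show "convex {0..1::real}"
      by simp
    fix t :: real
    assume "t \<in> {0..1}"
    then have t: "0 \<le> t" "c - t > 0" "c + t > 0"
      using assms by auto
    show "(?h has_real_derivative ?h' t) (at t)"
      using t by (auto intro!: derivative_eq_intros simp: algebra_simps)
    show "(?h' has_real_derivative ?h'' t) (at t)"
      using t by (auto intro!: derivative_eq_intros simp: algebra_simps)
    have "(c + t) powr (- s - 2) \<le> (c - t) powr (- s - 2)"
      using t assms by (intro powr_mono2') auto
    then show "?h'' t \<ge> 0"
      using assms by simp
  qed
  from convex_onD[OF this, of "1/2" 0 1] show ?thesis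
    by simp
qed

text \<open>Strict midpoint convexity without derivatives:
  \<open>x * (x + 2) < (x + 1)\<^sup>2\<close> compares the middle value with the geometric mean of
  the outer ones, which is at most their arithmetic mean.\<close>

lemma powr_neg_midpoint_less:
  fixes x s :: real
  assumes "x > 0" "s > 0"
  shows "2 * (x + 1) powr - s < x powr - s + (x + 2) powr - s"
proof -
  have "((x + 1) powr (- s / 2))\<^sup>2 = ((x + 1)\<^sup>2) powr (- s / 2)"
    using assms by (simp add: power2_eq_square powr_mult)
  also have "\<dots> < (x * (x + 2)) powr (- s / 2)"
    using assms by (intro powr_less_mono2_neg) (auto simp: power2_eq_square algebra_simps add_pos_pos)
  also have "\<dots> = x powr (- s / 2) * (x + 2) powr (- s / 2)"
    using assms by (simp add: powr_mult)
  finally have "2 * ((x + 1) powr (- s / 2))\<^sup>2 < 2 * (x powr (- s / 2) * (x + 2) powr (- s / 2))"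
    by simp
  also have "\<dots> \<le> (x powr (- s / 2))\<^sup>2 + ((x + 2) powr (- s / 2))\<^sup>2"
    using sum_squares_bound[of "x powr (- s / 2)" "(x + 2) powr (- s / 2)"] by simp
  finally show ?thesis
    by (simp add: power2_eq_square flip: powr_add)
qed

lemma sums_powr_neg_telescope:
  fixes a s :: real
  assumes "s > 0"
  shows "(\<lambda>j. ((a + 2 * real j) powr - s - (a + 2 * real j + 2) powr - s) / 2) sums (a powr - s / 2)"
proof -
  have "(\<lambda>j. (a + 2 * real j) powr - s) \<longlonglongrightarrow> 0"
  proof (rule tendsto_neg_powr)
    show "filterlim (\<lambda>j. a + 2 * real j) at_top sequentially"
      by (intro filterlim_tendsto_add_at_top[OF tendsto_const]
          filterlim_tendsto_pos_mult_at_top[OF tendsto_const] filterlim_real_sequentially) simp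
  qed (use assms in simp)
  from sums_divide[OF telescope_sums'[OF this], of 2] show ?thesis
    by (simp add: algebra_simps)
qed

lemma A_term_eq:
  "1 / real (n + 2 * j) powr s - 1 / real (n + 2 * j + 1) powr s =
    (real n + 2 * real j) powr - s - (real n + 2 * real j + 1) powr - s"
  by (simp add: powr_minus_divide algebra_simps)

lemma A_term_le:
  assumes "n > 0" "s > 0"
  shows "1 / real (n + 2 * j) powr s - 1 / real (n + 2 * j + 1) powr s
    \<le> ((real n - 1/2 + 2 * real j) powr - s - (real n - 1/2 + 2 * real j + 2) powr - s) / 2"
  \<comment> \<open>The centre is the midpoint of the two arguments in the term. The points at
    distance 1 from it are 2 apart, matching the step in \<open>j\<close>, so the bounds
    telescope.\<close>
  using powr_neg_central_difference[of "real n + 2 * real j + 1/2" s] assms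
  unfolding A_term_eq by (simp add: algebra_simps)

lemma A_summable:
  assumes "n > 0" "s > 0"
  shows "summable (\<lambda>j. 1 / real (n + 2 * j) powr s - 1 / real (n + 2 * j + 1) powr s)"
proof (rule summable_comparison_test')
  show "summable (\<lambda>j. ((real n - 1/2 + 2 * real j) powr - s
      - (real n - 1/2 + 2 * real j + 2) powr - s) / 2)"
    using sums_powr_neg_telescope[OF \<open>s > 0\<close>] by (rule sums_summable)
  fix j :: nat
  have "(real n + 2 * real j + 1) powr - s \<le> (real n + 2 * real j) powr - s"
    using assms by (intro powr_mono2') auto
  then show "norm (1 / real (n + 2 * j) powr s - 1 / real (n + 2 * j + 1) powr s)
      \<le> ((real n - 1/2 + 2 * real j) powr - s - (real n - 1/2 + 2 * real j + 2) powr - s) / 2"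
    using A_term_le[OF assms, of j] unfolding A_term_eq by simp
qed

lemma A_upper:
  assumes "n > 0" "s > 0"
  shows "A n s \<le> (real n - 1/2) powr - s / 2"
  unfolding A_def
  by (rule sums_le[OF A_term_le[OF assms] summable_sums[OF A_summable[OF assms]]
        sums_powr_neg_telescope[OF \<open>s > 0\<close>]])

lemma A_lower:
  assumes "n > 0" "s > 0"
  shows "real n powr - s / 2 < A n s"
proof -
  let ?d = "\<lambda>j. (1 / real (n + 2 * j) powr s - 1 / real (n + 2 * j + 1) powr s)
    - ((real n + 2 * real j) powr - s - (real n + 2 * real j + 2) powr - s) / 2"
  have sums: "?d sums (A n s - real n powr - s / 2)"
    unfolding A_def
    by (intro sums_diff summable_sums[OF A_summable[OF assms]] sums_powr_neg_telescope \<open>s > 0\<close>)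
  \<comment> \<open>With \<open>x = n + 2 * j\<close>, this difference is the mean of the values at
    \<open>x\<close> and \<open>x + 2\<close> minus the value at \<open>x + 1\<close>.\<close>
  have "?d j > 0" for j
    using powr_neg_midpoint_less[of "real n + 2 * real j" s] assms
    unfolding A_term_eq by (simp add: field_simps)
  then have "suminf ?d > 0"
    by (intro suminf_pos sums_summable[OF sums])
  then show ?thesis
    using sums_unique[OF sums] by simp
qed

lemma inverse_A_bounds:
  assumes "n > 0" "s > 0"
  shows "2 * (real n - 1/2) powr s \<le> 1 / A n s" and "1 / A n s < 2 * real n powr s"
proof -
  have "real n powr - s / 2 > 0"
    using assms by simp
  then have "A n s > 0"
    using A_lower[OF assms] by linarith
  moreover have "(real n - 1/2) powr s > 0" "real n powr s > 0"
    using assms by auto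
  ultimately show "2 * (real n - 1/2) powr s \<le> 1 / A n s" "1 / A n s < 2 * real n powr s"
    using A_upper[OF assms] A_lower[OF assms] by (auto simp: powr_minus field_simps)
qed

lemma B_eq_uminus_A: "n > 0 \<Longrightarrow> s > 0 \<Longrightarrow> B n s = - A n s"
  using suminf_minus[OF A_summable] unfolding A_def B_def by (simp add: algebra_simps)

lemma power4_mod_16:
  fixes m :: int
  shows "m ^ 4 mod 16 \<in> {0, 1}"
proof -
  have "m mod 16 \<in> {0..<16}"
    by simp
  also have "{0..<16} = {0, 1, 2, 3, 4, 5, 6, 7, 8, 9, 10, 11, 12, 13, 14, 15::int}"
    by (auto; presburger)
  finally have "(m mod 16) ^ 4 mod 16 \<in> {0, 1}"
    by auto
  then show ?thesis
    by (simp add: power_mod)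
qed

text \<open>The upper bound has to be strict: \<open>m ^ 4 = 16 * n\<close> does occur, for instance
  with \<open>n = 1\<close> and \<open>m = 2\<close>.\<close>

lemma no_int_in_gap:
  fixes m :: int
  assumes "n > 0"
    and lower: "2 * (real n - 1/2) powr (1/4) \<le> real_of_int m"
    and upper: "real_of_int m < 2 * real n powr (1/4)"
  shows False
proof -
  have pow4: "(2 * x powr (1/4)) ^ 4 = 16 * x" if "x > 0" for x :: real
    using that by (simp add: power_mult_distrib powr_power)
  have "(2 * (real n - 1/2) powr (1/4)) ^ 4 \<le> real_of_int m ^ 4"
    using lower by (intro power_mono) auto
  then have "real_of_int (16 * int n - 8) \<le> real_of_int (m ^ 4)"
    using assms(1) by (subst (asm) pow4) auto
  then have "16 * int n - 8 \<le> m ^ 4"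
    by linarith
  moreover have "0 \<le> real_of_int m"
    using lower by (rule order_trans[rotated]) simp
  then have "real_of_int m ^ 4 < (2 * real n powr (1/4)) ^ 4"
    using upper by (intro power_strict_mono) auto
  then have "real_of_int (m ^ 4) < real_of_int (16 * int n)"
    using assms(1) by (subst (asm) pow4) auto
  then have "m ^ 4 < 16 * int n"
    by linarith
  moreover have "m ^ 4 mod 16 = 0 \<or> m ^ 4 mod 16 = 1"
    using power4_mod_16[of m] by simp
  ultimately show False
    \<comment> \<open>The residue of \<open>m ^ 4\<close> modulo 16 would have to lie between 8 and
      15.\<close>
    by presburger
qed

theorem theorem2p12:
  shows "(\<forall>n::nat. n > 0 \<and> even n \<longrightarrow>
            \<lfloor>1 / A n (1/4)\<rfloor> = \<lfloor>2 * (real n - 1/2) powr (1/4)\<rfloor>) \<and>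
         (\<forall>n::nat. n > 0 \<and> odd n \<longrightarrow>
            \<lfloor>1 / B n (1/4)\<rfloor> = \<lfloor>- 2 * (real n - 1/2) powr (1/4)\<rfloor>)"
proof (intro conjI allI impI; elim conjE)
  fix n :: nat
  assume n: "n > 0"
  let ?u = "2 * (real n - 1/2) powr (1/4)" and ?v = "1 / A n (1/4)"
  have bounds: "?u \<le> ?v" "?v < 2 * real n powr (1/4)"
    using inverse_A_bounds[OF n, of "1/4"] by auto
  show "\<lfloor>?v\<rfloor> = \<lfloor>?u\<rfloor>"
  proof (rule antisym)
    show "\<lfloor>?v\<rfloor> \<le> \<lfloor>?u\<rfloor>"
    proof (rule ccontr)
      assume "\<not> \<lfloor>?v\<rfloor> \<le> \<lfloor>?u\<rfloor>"
      \<comment> \<open>If the floors differ, \<open>\<lfloor>?v\<rfloor>\<close> is an integer in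
        the forbidden gap.\<close>
      then have "?u \<le> real_of_int \<lfloor>?v\<rfloor>"
        by linarith
      with n show False
        by (rule no_int_in_gap) (use bounds in linarith)
    qed
  qed (use bounds in \<open>simp add: floor_mono\<close>)
  \<comment> \<open>Since \<open>B\<close> is the negative of \<open>A\<close>, floors of the
    negated quantities are needed, that is, ceilings of \<open>?v\<close> and \<open>?u\<close>.
    Here the integer in the gap would be \<open>\<lceil>?u\<rceil>\<close>.\<close>
  have "\<lceil>?v\<rceil> = \<lceil>?u\<rceil>"
  proof (rule antisym)
    show "\<lceil>?v\<rceil> \<le> \<lceil>?u\<rceil>"
    proof (rule ccontr)
      assume "\<not> \<lceil>?v\<rceil> \<le> \<lceil>?u\<rceil>"
      then have "real_of_int \<lceil>?u\<rceil> < ?v"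
        by linarith
      with n show False
        by (intro no_int_in_gap[of n "\<lceil>?u\<rceil>"]) (use bounds in linarith)+
    qed
  qed (use bounds in \<open>simp add: ceiling_mono\<close>)
  then show "\<lfloor>1 / B n (1/4)\<rfloor> = \<lfloor>- 2 * (real n - 1/2) powr (1/4)\<rfloor>"
    using B_eq_uminus_A[OF n, of "1/4"] by (simp add: ceiling_def)
qed

end
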